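(* Let $k\ge1$, $\Delta>0$, $n>k$, let $X$ be the stationary Gaussian solution of the affine stochastic delay differential equation described in the context, and assume that $K_\theta(t)=E_\theta(X(0)X(t))$ is continuously differentiable with respect to $\theta\in\Theta\subseteq\mathbb{R}^p$. Then the pseudo-score function of depth $k$ is a prediction-based estimating function of the form $A(\theta)\sum_{i=k}^{n-1}H_i(\theta)$; precisely, $$\partial_\theta\log\tilde L_n(\theta)=\tilde A(\theta)\sum_{i=k}^{n-1}H_i(\theta),\qquad \tilde A(\theta)=\begin{pmatrix}\dfrac{\partial_\theta\phi_k(\theta)^T}{v_k(\theta)}&\dfrac{\partial_\theta v_k(\theta)}{2v_k(\theta)^2}\end{pmatrix},$$ and the weight matrix satisfies $$\tilde A(\theta)=-S(\theta)M^{(1)}(\theta)^{-1},$$ where $S(\theta)^T=E_\theta(\partial_{\theta^T}H_i(\theta))=-\begin{pmatrix}\mathcal K_k(\theta)\,\partial_{\theta^T}\phi_k(\theta)\\ \partial_{\theta^T}v_k(\theta)\end{pmatrix}$ and $M^{(1)}(\theta)=E_\theta(H_k(\theta)H_k(\theta)^T)=\begin{pmatrix}v_k(\theta)\mathcal K_k(\theta)&O_{k,1}\\O_{1,k}&2v_k(\theta)^2\end{pmatrix}$.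
   Context: Model. For $\theta\in\Theta$, $X$ solves $dX(t)=\left(\int_{-r}^0X(t+s)\,a_\alpha(ds)\right)dt+\sigma\,dW(t)$, where $W$ is a Wiener process, $0\le r<\infty$, $\sigma>0$, and $a_\alpha$ is a measure on $[-r,0]$ depending on a parameter $\alpha$ such that the equation has a unique stationary solution. The parameter is $\theta=(\alpha,\sigma)$ or $\theta=(\alpha,\sigma,r)$. The initial segment $\{X(s):s\in[-r,0]\}$ has the stationary distribution, so $X$ is a stationary zero-mean Gaussian process. $E_\theta$ is expectation under $\theta$. The data are $X(\Delta),\ldots,X(n\Delta)$. Notation. $K_\theta(-t)=K_\theta(t)$. $\kappa_k(\theta)=(K_\theta(\Delta),\ldots,K_\theta(k\Delta))^T$; $\mathcal K_k(\theta)=\{K_\theta((i-j)\Delta)\}_{i,j=1,\ldots,k}$ (nondegenerate); $\phi_k(\theta)=\mathcal K_k(\theta)^{-1}\kappa_k(\theta)$; $v_k(\theta)=K_\theta(0)-\kappa_k(\theta)^T\mathcal K_k(\theta)^{-1}\kappa_k(\theta)>0$. $X_{i:j}=(X(i\Delta),X((i-1)\Delta),\ldots,X(j\Delta))^T$ for $i\ge j\ge1$. $O_{j_1,j_2}$ is the $j_1\times j_2$ zero matrix. $\partial_\theta$ puts derivatives with respect to $\theta_1,\ldots,\theta_p$ in rows (so $\partial_\theta\phi_k(\theta)^T$ is $p\times k$ and $\partial_\theta v_k(\theta)$ is $p\times 1$); $\partial_{\theta^T}$ puts them in columns. With $e_i(\theta)=X((i+1)\Delta)-\phi_k(\theta)^TX_{i:i+1-k}$,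 $i=k,\ldots,n-1$: $$H_i(\theta)=\begin{pmatrix}X_{i:i+1-k}\,e_i(\theta)\\ e_i(\theta)^2-v_k(\theta)\end{pmatrix}\in\mathbb{R}^{k+1}.$$ The pseudo-likelihood function of depth $k$ is $\tilde L_n(\theta)=\prod_{i=k}^{n-1}\frac{1}{\sqrt{2\pi v_k(\theta)}}\exp\left(-\frac{e_i(\theta)^2}{2v_k(\theta)}\right)$, and the pseudo-score function is $\partial_\theta\log\tilde L_n(\theta)$. *)

theory Defs
  imports "HOL-Probability.Probability"
begin

section \<open>Processes\<close>

text \<open>
  A process is a map \<open>time \<Rightarrow> sample point \<Rightarrow> value\<close>; only its values at times in an
  index set \<open>T\<close> are relevant.  Laws live on the product sigma-algebra, so equality of
  laws is equality of all finite-dimensional distributions.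
\<close>

definition path_law :: "'w measure \<Rightarrow> real set \<Rightarrow> (real \<Rightarrow> 'w \<Rightarrow> real) \<Rightarrow> (real \<Rightarrow> real) measure" where
  "path_law M T X = distr M (PiM T (\<lambda>_. borel)) (\<lambda>\<omega>. \<lambda>t\<in>T. X t \<omega>)"

definition stationary_process :: "'w measure \<Rightarrow> real set \<Rightarrow> (real \<Rightarrow> 'w \<Rightarrow> real) \<Rightarrow> bool" where
  "stationary_process M T X \<longleftrightarrow>
     (\<forall>t\<in>T. X t \<in> borel_measurable M) \<and>
     (\<forall>h\<ge>0. path_law M T (\<lambda>t. X (t + h)) = path_law M T X)"

definition normal_rv :: "'w measure \<Rightarrow> ('w \<Rightarrow> real) \<Rightarrow> real \<Rightarrow> real \<Rightarrow> bool" where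
  "normal_rv M Y m s \<longleftrightarrow>
     Y \<in> borel_measurable M \<and> s \<ge> 0 \<and>
     (if s = 0 then (AE \<omega> in M. Y \<omega> = m) else distributed M lborel Y (normal_density m s))"

definition centred_gaussian_process :: "'w measure \<Rightarrow> real set \<Rightarrow> (real \<Rightarrow> 'w \<Rightarrow> real) \<Rightarrow> bool" where
  "centred_gaussian_process M T X \<longleftrightarrow>
     (\<forall>F c. finite F \<and> F \<subseteq> T \<longrightarrow> (\<exists>s. normal_rv M (\<lambda>\<omega>. \<Sum>t\<in>F. c t * X t \<omega>) 0 s))"

definition wiener_process :: "'w measure \<Rightarrow> (real \<Rightarrow> 'w \<Rightarrow> real) \<Rightarrow> bool" where
  "wiener_process M W \<longleftrightarrow>
     (\<forall>t\<ge>0. W t \<in> borel_measurable M) \<and>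
     (AE \<omega> in M. W 0 \<omega> = 0 \<and> continuous_on {0..} (\<lambda>t. W t \<omega>)) \<and>
     (\<forall>s t. 0 \<le> s \<and> s < t \<longrightarrow>
        distributed M lborel (\<lambda>\<omega>. W t \<omega> - W s \<omega>) (normal_density 0 (sqrt (t - s)))) \<and>
     (\<forall>\<tau> :: nat \<Rightarrow> real. strict_mono \<tau> \<and> \<tau> 0 \<ge> 0 \<longrightarrow>
        (\<forall>m. prob_space.indep_vars M (\<lambda>_. borel) (\<lambda>i \<omega>. W (\<tau> (Suc i)) \<omega> - W (\<tau> i) \<omega>) {..<m}))"


section \<open>The affine stochastic delay differential equation\<close>

text \<open>
  The delay measure must be allowed to be signed (with a nonnegative delay measure there is
  no stationary solution).  It is given as a pair \<open>(\<mu>, \<nu>)\<close> of finite Borel measures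
  concentrated on \<open>[-r, 0]\<close>, standing for \<open>\<mu> - \<nu>\<close>.
\<close>

definition delay_measure :: "real \<Rightarrow> real measure \<times> real measure \<Rightarrow> bool" where
  "delay_measure r a \<longleftrightarrow>
     (\<forall>\<mu>\<in>{fst a, snd a}. finite_measure \<mu> \<and> sets \<mu> = sets borel \<and> emeasure \<mu> (- {-r..0}) = 0)"

definition delay_integral :: "real \<Rightarrow> real measure \<times> real measure \<Rightarrow> (real \<Rightarrow> real) \<Rightarrow> real" where
  "delay_integral r a f = (LINT s:{-r..0}|fst a. f s) - (LINT s:{-r..0}|snd a. f s)"

text \<open>
  The noise is additive, so the equation is meaningful pathwise in integrated form.  As usual,
  paths are continuous and the initial segment is independent of the driving Wiener process.
\<close>

definition stationary_sdde_solution ::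
  "'w measure \<Rightarrow> real \<Rightarrow> real measure \<times> real measure \<Rightarrow> real \<Rightarrow>
   (real \<Rightarrow> 'w \<Rightarrow> real) \<Rightarrow> (real \<Rightarrow> 'w \<Rightarrow> real) \<Rightarrow> bool" where
  "stationary_sdde_solution M r a \<sigma> W X \<longleftrightarrow>
     prob_space M \<and>
     wiener_process M W \<and>
     stationary_process M {-r..} X \<and>
     prob_space.indep_var M (PiM {-r..0} (\<lambda>_. borel)) (\<lambda>\<omega>. \<lambda>t\<in>{-r..0}. X t \<omega>)
                            (PiM {0..} (\<lambda>_. borel)) (\<lambda>\<omega>. \<lambda>t\<in>{0..}. W t \<omega>) \<and>
     (AE \<omega> in M. continuous_on {-r..} (\<lambda>t. X t \<omega>) \<and>
        (\<forall>t\<ge>0. X t \<omega> = X 0 \<omega> + (LBINT u:{0..t}. delay_integral r a (\<lambda>s. X (u + s) \<omega>)) + \<sigma> * W t \<omega>))"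

text \<open>
  Existence of a stationary solution and uniqueness of its law.  Every solution can be
  transferred to a space of pairs (path of \<open>X\<close>, path of \<open>W\<close>), so it is no
  restriction to let the sample points be such pairs.
\<close>

definition unique_stationary_solution :: "real \<Rightarrow> real measure \<times> real measure \<Rightarrow> real \<Rightarrow> bool" where
  "unique_stationary_solution r a \<sigma> \<longleftrightarrow>
     (\<exists>!L. \<exists>(M :: ((real \<Rightarrow> real) \<times> (real \<Rightarrow> real)) measure) W X.
        stationary_sdde_solution M r a \<sigma> W X \<and> L = path_law M {-r..} X)"

text \<open>
  The parameter is \<open>(\<alpha>, \<sigma>)\<close>, with \<open>r\<close> known, or \<open>(\<alpha>, \<sigma>, r)\<close>: one coordinate of
  \<open>\<theta>\<close> is \<open>\<sigma>\<close>, possibly another one is \<open>r\<close>, and the delay measure, which lives on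
  \<open>[-r, 0]\<close>, does not depend on \<open>\<sigma>\<close>.
\<close>

definition sdde_parametrization ::
  "(real^'p) set \<Rightarrow> (real^'p \<Rightarrow> real) \<Rightarrow> (real^'p \<Rightarrow> real measure \<times> real measure) \<Rightarrow>
   (real^'p \<Rightarrow> real) \<Rightarrow> bool" where
  "sdde_parametrization \<Theta> r a \<sigma> \<longleftrightarrow>
     (\<exists>j. (\<forall>\<theta>\<in>\<Theta>. \<sigma> \<theta> = \<theta> $ j) \<and>
          (\<forall>\<theta>\<in>\<Theta>. \<forall>\<eta>\<in>\<Theta>. (\<forall>l. l \<noteq> j \<longrightarrow> \<theta> $ l = \<eta> $ l) \<longrightarrow> a \<theta> = a \<eta>) \<and>
          ((\<exists>c. \<forall>\<theta>\<in>\<Theta>. r \<theta> = c) \<or> (\<exists>l. l \<noteq> j \<and> (\<forall>\<theta>\<in>\<Theta>. r \<theta> = \<theta> $ l))))"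

text \<open>
  The observed process \<open>X\<close> is the same for all \<open>\<theta>\<close>; only the probability measure varies.
  Gaussianity is a known property of the stationary solution and is part of the model here.
\<close>

definition gaussian_sdde_model ::
  "(real^'p) set \<Rightarrow> (real^'p \<Rightarrow> 'w measure) \<Rightarrow> (real^'p \<Rightarrow> real) \<Rightarrow>
   (real^'p \<Rightarrow> real measure \<times> real measure) \<Rightarrow> (real^'p \<Rightarrow> real) \<Rightarrow> (real \<Rightarrow> 'w \<Rightarrow> real) \<Rightarrow> bool" where
  "gaussian_sdde_model \<Theta> P r a \<sigma> X \<longleftrightarrow>
     sdde_parametrization \<Theta> r a \<sigma> \<and>
     (\<forall>\<theta>\<in>\<Theta>. \<forall>\<eta>\<in>\<Theta>. sets (P \<theta>) = sets (P \<eta>)) \<and>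
     (\<forall>\<theta>\<in>\<Theta>. 0 \<le> r \<theta> \<and> 0 < \<sigma> \<theta> \<and> delay_measure (r \<theta>) (a \<theta>) \<and>
        unique_stationary_solution (r \<theta>) (a \<theta>) (\<sigma> \<theta>) \<and>
        (\<exists>W. stationary_sdde_solution (P \<theta>) (r \<theta>) (a \<theta>) (\<sigma> \<theta>) W X) \<and>
        centred_gaussian_process (P \<theta>) {-r \<theta>..} X)"


section \<open>Derivatives and block matrices\<close>

text \<open>
  \<open>jacobian f (at \<theta>)\<close> has the derivatives with respect to the coordinates of \<open>\<theta>\<close> in its
  columns; \<open>grad\<close> is the version for real-valued functions, read as a column.
\<close>

definition grad :: "(real^'p \<Rightarrow> real) \<Rightarrow> real^'p \<Rightarrow> real^'p" where
  "grad f \<theta> = (\<chi> j. frechet_derivative f (at \<theta>) (axis j 1))"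

definition continuously_differentiable_on :: "(real^'p \<Rightarrow> real) \<Rightarrow> (real^'p) set \<Rightarrow> bool" where
  "continuously_differentiable_on f S \<longleftrightarrow>
     (\<forall>\<theta>\<in>S. f differentiable (at \<theta>)) \<and> continuous_on S (grad f)"

definition hcat :: "real^'a^'m \<Rightarrow> real^'b^'m \<Rightarrow> real^('a + 'b)^'m" where
  "hcat A B = (\<chi> i j. case j of Inl l \<Rightarrow> A $ i $ l | Inr l \<Rightarrow> B $ i $ l)"

definition vcat :: "real^'m^'a \<Rightarrow> real^'m^'b \<Rightarrow> real^'m^('a + 'b)" where
  "vcat A B = (\<chi> i. case i of Inl l \<Rightarrow> A $ l | Inr l \<Rightarrow> B $ l)"

definition append_scalar :: "real^'k \<Rightarrow> real \<Rightarrow> real^('k + 1)" where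
  "append_scalar x y = (\<chi> i. case i of Inl l \<Rightarrow> x $ l | Inr _ \<Rightarrow> y)"


section \<open>The pseudo-likelihood\<close>

text \<open>
  Throughout, \<open>k = CARD('k)\<close>, and \<open>lag :: 'k \<Rightarrow> nat\<close> is a bijection onto \<open>{1..k}\<close> that gives the
  position of a coordinate in a vector of \<open>\<real>\<^sup>k\<close>.  \<open>K\<close> is the autocovariance function.
\<close>

definition autocov :: "(real^'p \<Rightarrow> 'w measure) \<Rightarrow> (real \<Rightarrow> 'w \<Rightarrow> real) \<Rightarrow> real^'p \<Rightarrow> real \<Rightarrow> real" where
  "autocov P X \<theta> t = (\<integral>\<omega>. X 0 \<omega> * X \<bar>t\<bar> \<omega> \<partial>P \<theta>)"

definition kappa :: "('k::finite \<Rightarrow> nat) \<Rightarrow> real \<Rightarrow> (real^'p \<Rightarrow> real \<Rightarrow> real) \<Rightarrow> real^'p \<Rightarrow> real^'k" where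
  "kappa lag \<Delta> K \<theta> = (\<chi> i. K \<theta> (real (lag i) * \<Delta>))"

definition Kmat :: "('k::finite \<Rightarrow> nat) \<Rightarrow> real \<Rightarrow> (real^'p \<Rightarrow> real \<Rightarrow> real) \<Rightarrow> real^'p \<Rightarrow> real^'k^'k" where
  "Kmat lag \<Delta> K \<theta> = (\<chi> i j. K \<theta> ((real (lag i) - real (lag j)) * \<Delta>))"

definition phi :: "('k::finite \<Rightarrow> nat) \<Rightarrow> real \<Rightarrow> (real^'p \<Rightarrow> real \<Rightarrow> real) \<Rightarrow> real^'p \<Rightarrow> real^'k" where
  "phi lag \<Delta> K \<theta> = matrix_inv (Kmat lag \<Delta> K \<theta>) *v kappa lag \<Delta> K \<theta>"

definition pvar :: "('k::finite \<Rightarrow> nat) \<Rightarrow> real \<Rightarrow> (real^'p \<Rightarrow> real \<Rightarrow> real) \<Rightarrow> real^'p \<Rightarrow> real" where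
  "pvar lag \<Delta> K \<theta> =
     K \<theta> 0 - kappa lag \<Delta> K \<theta> \<bullet> (matrix_inv (Kmat lag \<Delta> K \<theta>) *v kappa lag \<Delta> K \<theta>)"

text \<open>\<open>lagged\<close> is \<open>(X(i\<Delta>), X((i-1)\<Delta>), \<dots>, X((i+1-k)\<Delta>))\<close>, for \<open>i \<ge> k\<close>.\<close>

definition lagged :: "('k::finite \<Rightarrow> nat) \<Rightarrow> real \<Rightarrow> (real \<Rightarrow> 'w \<Rightarrow> real) \<Rightarrow> nat \<Rightarrow> 'w \<Rightarrow> real^'k" where
  "lagged lag \<Delta> X i \<omega> = (\<chi> j. X (real (i + 1 - lag j) * \<Delta>) \<omega>)"

definition pred_error ::
  "('k::finite \<Rightarrow> nat) \<Rightarrow> real \<Rightarrow> (real^'p \<Rightarrow> real \<Rightarrow> real) \<Rightarrow> (real \<Rightarrow> 'w \<Rightarrow> real) \<Rightarrow> nat \<Rightarrow> real^'p \<Rightarrow> 'w \<Rightarrow> real" where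
  "pred_error lag \<Delta> K X i \<theta> \<omega> =
     X (real (i + 1) * \<Delta>) \<omega> - phi lag \<Delta> K \<theta> \<bullet> lagged lag \<Delta> X i \<omega>"

definition Hvec ::
  "('k::finite \<Rightarrow> nat) \<Rightarrow> real \<Rightarrow> (real^'p \<Rightarrow> real \<Rightarrow> real) \<Rightarrow> (real \<Rightarrow> 'w \<Rightarrow> real) \<Rightarrow> nat \<Rightarrow> real^'p \<Rightarrow> 'w \<Rightarrow> real^('k + 1)" where
  "Hvec lag \<Delta> K X i \<theta> \<omega> =
     append_scalar (pred_error lag \<Delta> K X i \<theta> \<omega> *\<^sub>R lagged lag \<Delta> X i \<omega>)
                   ((pred_error lag \<Delta> K X i \<theta> \<omega>)\<^sup>2 - pvar lag \<Delta> K \<theta>)"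

definition pseudo_likelihood ::
  "('k::finite \<Rightarrow> nat) \<Rightarrow> real \<Rightarrow> (real^'p \<Rightarrow> real \<Rightarrow> real) \<Rightarrow> (real \<Rightarrow> 'w \<Rightarrow> real) \<Rightarrow> nat \<Rightarrow> real^'p \<Rightarrow> 'w \<Rightarrow> real" where
  "pseudo_likelihood lag \<Delta> K X n \<theta> \<omega> =
     (\<Prod>i = CARD('k)..<n. 1 / sqrt (2 * pi * pvar lag \<Delta> K \<theta>) *
        exp (- (pred_error lag \<Delta> K X i \<theta> \<omega>)\<^sup>2 / (2 * pvar lag \<Delta> K \<theta>)))"

definition pseudo_score ::
  "('k::finite \<Rightarrow> nat) \<Rightarrow> real \<Rightarrow> (real^'p \<Rightarrow> real \<Rightarrow> real) \<Rightarrow> (real \<Rightarrow> 'w \<Rightarrow> real) \<Rightarrow> nat \<Rightarrow> real^'p \<Rightarrow> 'w \<Rightarrow> real^'p" where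
  "pseudo_score lag \<Delta> K X n \<theta> \<omega> = grad (\<lambda>\<eta>. ln (pseudo_likelihood lag \<Delta> K X n \<eta> \<omega>)) \<theta>"

text \<open>Prediction-based estimating functions of the form considered: the weights are nonrandom.\<close>

definition prediction_based_estimating_function ::
  "('k::finite \<Rightarrow> nat) \<Rightarrow> real \<Rightarrow> (real^'p \<Rightarrow> real \<Rightarrow> real) \<Rightarrow> (real \<Rightarrow> 'w \<Rightarrow> real) \<Rightarrow> nat \<Rightarrow>
   (real^'p) set \<Rightarrow> 'w set \<Rightarrow> (real^'p \<Rightarrow> 'w \<Rightarrow> real^'p) \<Rightarrow> bool" where
  "prediction_based_estimating_function lag \<Delta> K X n \<Theta> \<Omega> G \<longleftrightarrow>
     (\<exists>A :: real^'p \<Rightarrow> real^('k + 1)^'p. \<forall>\<theta>\<in>\<Theta>. \<forall>\<omega>\<in>\<Omega>.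
        G \<theta> \<omega> = A \<theta> *v (\<Sum>i = CARD('k)..<n. Hvec lag \<Delta> K X i \<theta> \<omega>))"

definition Atilde ::
  "('k::finite \<Rightarrow> nat) \<Rightarrow> real \<Rightarrow> (real^'p \<Rightarrow> real \<Rightarrow> real) \<Rightarrow> real^'p \<Rightarrow> real^('k + 1)^'p" where
  "Atilde lag \<Delta> K \<theta> =
     hcat ((1 / pvar lag \<Delta> K \<theta>) *\<^sub>R transpose (jacobian (phi lag \<Delta> K) (at \<theta>)))
          ((1 / (2 * (pvar lag \<Delta> K \<theta>)\<^sup>2)) *\<^sub>R (columnvector (grad (pvar lag \<Delta> K) \<theta>) :: real^1^'p))"

text \<open>\<open>sensitivity\<close> does not depend on \<open>i\<close>; this is part of the theorem.\<close>

definition sensitivity ::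
  "('k::finite \<Rightarrow> nat) \<Rightarrow> real \<Rightarrow> (real^'p \<Rightarrow> 'w measure) \<Rightarrow> (real \<Rightarrow> 'w \<Rightarrow> real) \<Rightarrow> nat \<Rightarrow> real^'p \<Rightarrow> real^('k + 1)^'p" where
  "sensitivity lag \<Delta> P X i \<theta> =
     transpose (\<integral>\<omega>. jacobian (\<lambda>\<eta>. Hvec lag \<Delta> (autocov P X) X i \<eta> \<omega>) (at \<theta>) \<partial>P \<theta>)"

definition outer :: "real^'m \<Rightarrow> real^'m^'m" where
  "outer x = (columnvector x :: real^1^'m) ** rowvector x"

definition M1 ::
  "('k::finite \<Rightarrow> nat) \<Rightarrow> real \<Rightarrow> (real^'p \<Rightarrow> 'w measure) \<Rightarrow> (real \<Rightarrow> 'w \<Rightarrow> real) \<Rightarrow> real^'p \<Rightarrow> real^('k + 1)^('k + 1)" where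
  "M1 lag \<Delta> P X \<theta> = (\<integral>\<omega>. outer (Hvec lag \<Delta> (autocov P X) X CARD('k) \<theta> \<omega>) \<partial>P \<theta>)"

end

theory Submission
  imports Defs
begin

text \<open>
  The one-step predictor \<open>\<phi>\<^sup>T X_{i:i+1-k}\<close> is the orthogonal projection of \<open>X((i+1)\<Delta>)\<close> on the \<open>k\<close>
  preceding observations, so the error \<open>e_i\<close> has variance \<open>v\<close> and is uncorrelated with them.
  Joint normality turns this into the fourth-moment formulas that make \<open>M\<^sup>(\<^sup>1\<^sup>)\<close> block diagonal;
  orthogonality alone makes the expected Jacobian of \<open>H_i\<close> explicit.  The score is read off by
  differentiating \<open>- ln (2 \<pi> v) / 2 - e_i\<^sup>2 / (2 v)\<close> termwise, and \<open>A M = - S\<close> is then block algebra.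
\<close>

section \<open>Moments of Gaussian families\<close>

text \<open>The kurtosis of a normal variable is 3. Expressing the fourth moment through the second
  one eliminates \<open>s\<close>, which is known only existentially for a Gaussian process. The
  case \<open>s = 0\<close> is a point mass without density and is treated separately.\<close>

lemma normal_rv_fourth_moment:
  assumes "normal_rv M Y 0 s"
  shows "integrable M (\<lambda>\<omega>. (Y \<omega>)\<^sup>2)"
    and "has_bochner_integral M (\<lambda>\<omega>. (Y \<omega>)^4) (3 * (\<integral>\<omega>. (Y \<omega>)\<^sup>2 \<partial>M)\<^sup>2)"
proof -
  have Y[measurable]: "Y \<in> borel_measurable M" and s: "s \<ge> 0"
    using assms by (auto simp: normal_rv_def)
  have m: "has_bochner_integral M (\<lambda>\<omega>. (Y \<omega>)^2) (s\<^sup>2) \<and> has_bochner_integral M (\<lambda>\<omega>. (Y \<omega>)^4) (3 * s^4)"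
  proof (cases "s = 0")
    case True
    then have ae: "AE \<omega> in M. Y \<omega> = 0" using assms by (simp add: normal_rv_def)
    have "has_bochner_integral M (\<lambda>\<omega>. (Y \<omega>)^k) 0" if "k > 0" for k
      by (rule has_bochner_integralI_AE[OF has_bochner_integral_zero]) (use ae that in auto)
    then show ?thesis using True by simp
  next
    case False
    then have D: "distributed M lborel Y (normal_density 0 s)" and pos: "s > 0"
      using assms s by (simp_all add: normal_rv_def)
    \<comment> \<open>The even moments \<open>(2k)! s^(2k) / (2^k k!)\<close>, which for
      \<open>k = 1\<close> and \<open>k = 2\<close> are \<open>s^2\<close> and
      \<open>3 s^4\<close>.\<close>
    have m: "has_bochner_integral M (\<lambda>\<omega>. (Y \<omega>)^(2*k)) (fact (2 * k) / ((2 / s\<^sup>2)^k * fact k))" for k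
      using normal_moment_even[OF pos, of 0 k]
        distributed_integrable[OF D, of "\<lambda>x. x^(2*k)"] distributed_integral[OF D, of "\<lambda>x. x^(2*k)"]
      by (simp add: has_bochner_integral_iff)
    show ?thesis
      using m[of 1] m[of 2] pos
      by (simp add: fact_numeral field_simps power2_eq_square power4_eq_xxxx)
  qed
  then show "integrable M (\<lambda>\<omega>. (Y \<omega>)\<^sup>2)"
    and "has_bochner_integral M (\<lambda>\<omega>. (Y \<omega>)^4) (3 * (\<integral>\<omega>. (Y \<omega>)\<^sup>2 \<partial>M)\<^sup>2)"
    by (simp_all add: has_bochner_integral_iff power2_eq_square power4_eq_xxxx)
qed

text \<open>The linear span of the process. Its elements are jointly Gaussian, because every linear
  combination of them lies in the span again and is therefore centred normal.\<close>

definition lincomb :: "real set \<Rightarrow> (real \<Rightarrow> 'w \<Rightarrow> real) \<Rightarrow> ('w \<Rightarrow> real) set" where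
  "lincomb T X = {Y. \<exists>F c. finite F \<and> F \<subseteq> T \<and> Y = (\<lambda>\<omega>. \<Sum>t\<in>F. c t * X t \<omega>)}"

lemma lincomb_base: "t \<in> T \<Longrightarrow> X t \<in> lincomb T X"
  by (auto simp: lincomb_def fun_eq_iff intro!: exI[of _ "{t}"] exI[of _ "\<lambda>_. 1"])

lemma lincomb_zero: "(\<lambda>\<omega>. 0) \<in> lincomb T X"
  by (auto simp: lincomb_def intro!: exI[of _ "{}"])

lemma lincomb_lin:
  assumes "U \<in> lincomb T X" "V \<in> lincomb T X"
  shows "(\<lambda>\<omega>. a * U \<omega> + b * V \<omega>) \<in> lincomb T X"
proof -
  obtain F c where F: "finite F" "F \<subseteq> T" "U = (\<lambda>\<omega>. \<Sum>t\<in>F. c t * X t \<omega>)"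
    using assms by (auto simp: lincomb_def)
  obtain G d where G: "finite G" "G \<subseteq> T" "V = (\<lambda>\<omega>. \<Sum>t\<in>G. d t * X t \<omega>)"
    using assms by (auto simp: lincomb_def)
  \<comment> \<open>Both coefficient families are extended by zero to \<open>F \<union> G\<close>,
    so that the two sums have a common index set.\<close>
  let ?c = "\<lambda>t. a * (if t \<in> F then c t else 0) + b * (if t \<in> G then d t else 0)"
  have "(\<Sum>t\<in>F. c t * X t \<omega>) = (\<Sum>t\<in>F \<union> G. (if t \<in> F then c t else 0) * X t \<omega>)" for \<omega>
    using F G by (intro sum.mono_neutral_cong_left) auto
  moreover have "(\<Sum>t\<in>G. d t * X t \<omega>) = (\<Sum>t\<in>F \<union> G. (if t \<in> G then d t else 0) * X t \<omega>)" for \<omega>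
    using F G by (intro sum.mono_neutral_cong_left) auto
  ultimately have "(\<lambda>\<omega>. a * U \<omega> + b * V \<omega>) = (\<lambda>\<omega>. \<Sum>t\<in>F \<union> G. ?c t * X t \<omega>)"
    by (simp only: F G sum_distrib_left sum.distrib[symmetric] distrib_right mult.assoc)
  then show ?thesis using F G unfolding lincomb_def
    by (intro CollectI exI[of _ "F \<union> G"] exI[of _ ?c]) simp
qed

lemma lincomb_sum:
  assumes "\<And>i. i \<in> I \<Longrightarrow> U i \<in> lincomb T X"
  shows "(\<lambda>\<omega>. \<Sum>i\<in>I. a i * U i \<omega>) \<in> lincomb T X"
  using assms
proof (induction I rule: infinite_finite_induct)
  case (insert i I)
  then have "(\<lambda>\<omega>. a i * U i \<omega> + 1 * (\<Sum>i\<in>I. a i * U i \<omega>)) \<in> lincomb T X"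
    by (intro lincomb_lin) auto
  then show ?case using insert by simp
\<comment> \<open>A sum over an infinite set is 0 by convention, so this case is the zero function,
  like the empty one.\<close>
qed (simp_all add: lincomb_zero)

section \<open>Mixed moments of order two and four in the Gaussian span\<close>

context
  fixes M :: "'w measure" and T X
  assumes gauss: "centred_gaussian_process M T X"
begin

lemma gaussian_lincomb: "Y \<in> lincomb T X \<Longrightarrow> \<exists>s. normal_rv M Y 0 s"
  using gauss by (auto simp: lincomb_def centred_gaussian_process_def)

lemma gaussian_integrable_power2:
  "Y \<in> lincomb T X \<Longrightarrow> integrable M (\<lambda>\<omega>. (Y \<omega>)\<^sup>2)"
  using gaussian_lincomb normal_rv_fourth_moment(1) by blast

lemma gaussian_power4:
  "Y \<in> lincomb T X \<Longrightarrow> has_bochner_integral M (\<lambda>\<omega>. (Y \<omega>)^4) (3 * (\<integral>\<omega>. (Y \<omega>)\<^sup>2 \<partial>M)\<^sup>2)"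
  using gaussian_lincomb normal_rv_fourth_moment(2) by blast

lemma gaussian_integrable_mult:
  assumes "U \<in> lincomb T X" "V \<in> lincomb T X"
  shows "integrable M (\<lambda>\<omega>. U \<omega> * V \<omega>)"
proof -
  \<comment> \<open>Polarization: \<open>U V = ((U + V)^2 - (U - V)^2) / 4\<close>, and both squares
    are integrable. The explicit coefficients 1 and -1 match the form of
    \<open>lincomb_lin\<close>.\<close>
  have "integrable M (\<lambda>\<omega>. ((1 * U \<omega> + 1 * V \<omega>)\<^sup>2 - (1 * U \<omega> + (-1) * V \<omega>)\<^sup>2) / 4)"
    using lincomb_lin[OF assms] gaussian_integrable_power2
    by (intro integrable_divide Bochner_Integration.integrable_diff) blast+
  then show ?thesis by (simp add: power2_eq_square algebra_simps)
qed

text \<open>The fourth moment of \<open>a U + b V\<close> becomes a quartic form in \<open>a\<close>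
  and \<open>b\<close> whose coefficients involve only the covariances of \<open>U\<close> and
  \<open>V\<close>.\<close>

lemma gaussian_fourth_moment_lin:
  assumes "U \<in> lincomb T X" "V \<in> lincomb T X"
  shows "has_bochner_integral M (\<lambda>\<omega>. (a * U \<omega> + b * V \<omega>)^4)
     (3 * (a\<^sup>2 * (\<integral>\<omega>. (U \<omega>)\<^sup>2 \<partial>M) + 2 * a * b * (\<integral>\<omega>. U \<omega> * V \<omega> \<partial>M) + b\<^sup>2 * (\<integral>\<omega>. (V \<omega>)\<^sup>2 \<partial>M))\<^sup>2)"
proof -
  have "(\<integral>\<omega>. (a * U \<omega> + b * V \<omega>)\<^sup>2 \<partial>M)
      = (\<integral>\<omega>. a\<^sup>2 * (U \<omega>)\<^sup>2 + (2 * a * b) * (U \<omega> * V \<omega>) + b\<^sup>2 * (V \<omega>)\<^sup>2 \<partial>M)"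
    by (simp add: power2_eq_square algebra_simps)
  also have "\<dots> = a\<^sup>2 * (\<integral>\<omega>. (U \<omega>)\<^sup>2 \<partial>M) + 2 * a * b * (\<integral>\<omega>. U \<omega> * V \<omega> \<partial>M) + b\<^sup>2 * (\<integral>\<omega>. (V \<omega>)\<^sup>2 \<partial>M)"
    using assms by (simp add: gaussian_integrable_power2 gaussian_integrable_mult)
  finally show ?thesis
    using gaussian_power4[OF lincomb_lin[OF assms, of a b]] by simp
qed

text \<open>
  The mixed fourth moments come from polarization: \<open>a U + b V\<close> is again centred normal, and comparing
  \<open>E (a U + b V)\<^sup>4 = 3 (E (a U + b V)\<^sup>2)\<^sup>2\<close> for a few \<open>a\<close>, \<open>b\<close> isolates them.
\<close>

lemma gaussian_moment_22:
  assumes "U \<in> lincomb T X" "V \<in> lincomb T X"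
  shows "has_bochner_integral M (\<lambda>\<omega>. (U \<omega>)\<^sup>2 * (V \<omega>)\<^sup>2)
     ((\<integral>\<omega>. (U \<omega>)\<^sup>2 \<partial>M) * (\<integral>\<omega>. (V \<omega>)\<^sup>2 \<partial>M) + 2 * (\<integral>\<omega>. U \<omega> * V \<omega> \<partial>M)\<^sup>2)" (is "has_bochner_integral _ ?f ?x")
proof -
  let ?q = "\<lambda>a b. 3 * (a\<^sup>2 * (\<integral>\<omega>. (U \<omega>)\<^sup>2 \<partial>M) + 2 * a * b * (\<integral>\<omega>. U \<omega> * V \<omega> \<partial>M) + b\<^sup>2 * (\<integral>\<omega>. (V \<omega>)\<^sup>2 \<partial>M))\<^sup>2"
  \<comment> \<open>\<open>(U + V)^4 + (U - V)^4 = 2 U^4 + 12 U^2 V^2 + 2 V^4\<close>. The pure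
    powers are the cases \<open>b = 0\<close> and \<open>a = 0\<close>, and what is left is divided
    by 12.\<close>
  have "has_bochner_integral M
      (\<lambda>\<omega>. ((1 * U \<omega> + 1 * V \<omega>)^4 + (1 * U \<omega> + (-1) * V \<omega>)^4
            - 2 * (1 * U \<omega> + 0 * V \<omega>)^4 - 2 * (0 * U \<omega> + 1 * V \<omega>)^4) / 12)
      ((?q 1 1 + ?q 1 (-1) - 2 * ?q 1 0 - 2 * ?q 0 1) / 12)"
    by (intro has_bochner_integral_divide_zero has_bochner_integral_add has_bochner_integral_diff
        has_bochner_integral_mult_right gaussian_fourth_moment_lin assms)
  moreover have "(\<lambda>\<omega>. ((1 * U \<omega> + 1 * V \<omega>)^4 + (1 * U \<omega> + (-1) * V \<omega>)^4
            - 2 * (1 * U \<omega> + 0 * V \<omega>)^4 - 2 * (0 * U \<omega> + 1 * V \<omega>)^4) / 12) = ?f"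
    by (rule ext) (simp add: power4_eq_xxxx power2_eq_square, algebra)
  moreover have "((?q 1 1 + ?q 1 (-1) - 2 * ?q 1 0 - 2 * ?q 0 1) / 12) = ?x"
    by (simp add: power2_eq_square, algebra)
  ultimately show ?thesis by (simp only:)
qed

lemma gaussian_moment_31:
  assumes "U \<in> lincomb T X" "V \<in> lincomb T X"
  shows "has_bochner_integral M (\<lambda>\<omega>. (U \<omega>)^3 * V \<omega>)
     (3 * (\<integral>\<omega>. (U \<omega>)\<^sup>2 \<partial>M) * (\<integral>\<omega>. U \<omega> * V \<omega> \<partial>M))" (is "has_bochner_integral _ ?f ?x")
proof -
  let ?q = "\<lambda>a b. 3 * (a\<^sup>2 * (\<integral>\<omega>. (U \<omega>)\<^sup>2 \<partial>M) + 2 * a * b * (\<integral>\<omega>. U \<omega> * V \<omega> \<partial>M) + b\<^sup>2 * (\<integral>\<omega>. (V \<omega>)\<^sup>2 \<partial>M))\<^sup>2"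
  \<comment> \<open>\<open>(U + b V)^4 - (U - b V)^4 = 8 b U^3 V + 8 b^3 U V^3\<close>. Eight times
    the case \<open>b = 1\<close> minus the case \<open>b = 2\<close> cancels \<open>U V^3\<close>
    and leaves \<open>48 U^3 V\<close>.\<close>
  have "has_bochner_integral M
      (\<lambda>\<omega>. (8 * ((1 * U \<omega> + 1 * V \<omega>)^4 - (1 * U \<omega> + (-1) * V \<omega>)^4)
            - ((1 * U \<omega> + 2 * V \<omega>)^4 - (1 * U \<omega> + (-2) * V \<omega>)^4)) / 48)
      ((8 * (?q 1 1 - ?q 1 (-1)) - (?q 1 2 - ?q 1 (-2))) / 48)"
    by (intro has_bochner_integral_divide_zero has_bochner_integral_add has_bochner_integral_diff
        has_bochner_integral_mult_right gaussian_fourth_moment_lin assms)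
  moreover have "(\<lambda>\<omega>. (8 * ((1 * U \<omega> + 1 * V \<omega>)^4 - (1 * U \<omega> + (-1) * V \<omega>)^4)
            - ((1 * U \<omega> + 2 * V \<omega>)^4 - (1 * U \<omega> + (-2) * V \<omega>)^4)) / 48) = ?f"
    by (rule ext) (simp add: power4_eq_xxxx power3_eq_cube, algebra)
  moreover have "((8 * (?q 1 1 - ?q 1 (-1)) - (?q 1 2 - ?q 1 (-2))) / 48) = ?x"
    by (simp add: power2_eq_square, algebra)
  ultimately show ?thesis by (simp only:)
qed

text \<open>Of the three pairings in Isserlis' formula, the two that pair \<open>U\<close> with
  \<open>V\<close> and with \<open>W\<close> vanish. The proof polarizes
  \<open>gaussian_moment_22\<close> in its second argument.\<close>

lemma gaussian_moment_211:
  assumes "U \<in> lincomb T X" "V \<in> lincomb T X" "W \<in> lincomb T X"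
    and UV: "(\<integral>\<omega>. U \<omega> * V \<omega> \<partial>M) = 0" and UW: "(\<integral>\<omega>. U \<omega> * W \<omega> \<partial>M) = 0"
  shows "has_bochner_integral M (\<lambda>\<omega>. (U \<omega>)\<^sup>2 * (V \<omega> * W \<omega>))
     ((\<integral>\<omega>. (U \<omega>)\<^sup>2 \<partial>M) * (\<integral>\<omega>. V \<omega> * W \<omega> \<partial>M))" (is "has_bochner_integral _ ?f ?x")
proof -
  \<comment> \<open>\<open>U\<close> is uncorrelated with every \<open>V + a W\<close>, so the
    squared covariance in \<open>gaussian_moment_22\<close> drops out.\<close>
  have c: "(\<integral>\<omega>. U \<omega> * (1 * V \<omega> + a * W \<omega>) \<partial>M) = 0" for a
  proof -
    have "(\<integral>\<omega>. U \<omega> * (1 * V \<omega> + a * W \<omega>) \<partial>M) = (\<integral>\<omega>. U \<omega> * V \<omega> + a * (U \<omega> * W \<omega>) \<partial>M)"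
      by (simp add: algebra_simps)
    then show ?thesis using assms by (simp add: gaussian_integrable_mult)
  qed
  have q: "(\<integral>\<omega>. (1 * V \<omega> + a * W \<omega>)\<^sup>2 \<partial>M)
      = (\<integral>\<omega>. (V \<omega>)\<^sup>2 \<partial>M) + 2 * a * (\<integral>\<omega>. V \<omega> * W \<omega> \<partial>M) + a\<^sup>2 * (\<integral>\<omega>. (W \<omega>)\<^sup>2 \<partial>M)" for a
  proof -
    have "(\<integral>\<omega>. (1 * V \<omega> + a * W \<omega>)\<^sup>2 \<partial>M)
        = (\<integral>\<omega>. (V \<omega>)\<^sup>2 + (2 * a) * (V \<omega> * W \<omega>) + a\<^sup>2 * (W \<omega>)\<^sup>2 \<partial>M)"
      by (simp add: power2_eq_square algebra_simps)
    then show ?thesis using assms by (simp add: gaussian_integrable_power2 gaussian_integrable_mult)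
  qed
  have h: "has_bochner_integral M (\<lambda>\<omega>. (U \<omega>)\<^sup>2 * (1 * V \<omega> + a * W \<omega>)\<^sup>2)
     ((\<integral>\<omega>. (U \<omega>)\<^sup>2 \<partial>M) * ((\<integral>\<omega>. (V \<omega>)\<^sup>2 \<partial>M) + 2 * a * (\<integral>\<omega>. V \<omega> * W \<omega> \<partial>M) + a\<^sup>2 * (\<integral>\<omega>. (W \<omega>)\<^sup>2 \<partial>M)))" for a
    using gaussian_moment_22[OF assms(1) lincomb_lin[OF assms(2,3), of 1 a]] by (simp only: c q) simp
  have "has_bochner_integral M (\<lambda>\<omega>. ((U \<omega>)\<^sup>2 * (1 * V \<omega> + 1 * W \<omega>)\<^sup>2 - (U \<omega>)\<^sup>2 * (1 * V \<omega> + (-1) * W \<omega>)\<^sup>2) / 4)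
     (((\<integral>\<omega>. (U \<omega>)\<^sup>2 \<partial>M) * ((\<integral>\<omega>. (V \<omega>)\<^sup>2 \<partial>M) + 2 * 1 * (\<integral>\<omega>. V \<omega> * W \<omega> \<partial>M) + 1\<^sup>2 * (\<integral>\<omega>. (W \<omega>)\<^sup>2 \<partial>M))
     - (\<integral>\<omega>. (U \<omega>)\<^sup>2 \<partial>M) * ((\<integral>\<omega>. (V \<omega>)\<^sup>2 \<partial>M) + 2 * (-1) * (\<integral>\<omega>. V \<omega> * W \<omega> \<partial>M) + (-1)\<^sup>2 * (\<integral>\<omega>. (W \<omega>)\<^sup>2 \<partial>M))) / 4)"
    (is "has_bochner_integral M ?g ?y")
    by (intro has_bochner_integral_divide_zero has_bochner_integral_diff h)
  moreover have "?g = ?f"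
    by (rule ext) (simp add: power2_eq_square algebra_simps)
  moreover have "?y = ?x"
    by (simp add: algebra_simps)
  ultimately show ?thesis by (simp only:)
qed

end

text \<open>A product of two coordinates is integrated against the law of the path, which is
  invariant under shifts. Shifting back by the smaller of the two times leaves the times 0 and
  \<open>\<bar>s - t\<bar>\<close>.\<close>

lemma stationary_second_moment:
  assumes "stationary_process M {-r..} X" "r \<ge> 0" "s \<ge> 0" "t \<ge> 0"
  shows "(\<integral>\<omega>. X s \<omega> * X t \<omega> \<partial>M) = (\<integral>\<omega>. X 0 \<omega> * X \<bar>s - t\<bar> \<omega> \<partial>M)"
proof -
  let ?T = "{-r..}"
  have m: "(\<lambda>\<omega>. \<lambda>t\<in>?T. X (t + h) \<omega>) \<in> measurable M (PiM ?T (\<lambda>_. borel))" if "h \<ge> 0" for h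
    using assms that by (intro measurable_restrict) (auto simp: stationary_process_def)
  have shift: "(\<integral>\<omega>. X u \<omega> * X (u + d) \<omega> \<partial>M) = (\<integral>\<omega>. X 0 \<omega> * X d \<omega> \<partial>M)" if "u \<ge> 0" "d \<ge> 0" for u d
  proof -
    have *: "(\<integral>p. p 0 * p d \<partial>path_law M ?T (\<lambda>t. X (t + h))) = (\<integral>\<omega>. X h \<omega> * X (d + h) \<omega> \<partial>M)" if "h \<ge> 0" for h
      unfolding path_law_def using m[OF that] assms \<open>d \<ge> 0\<close>
      by (subst integral_distr) auto
    \<comment> \<open>The unshifted law is written as a shift by 0, so that \<open>*\<close>
      evaluates both sides.\<close>
    have "path_law M ?T (\<lambda>t. X (t + u)) = path_law M ?T (\<lambda>t. X (t + 0))"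
      using assms that by (simp add: stationary_process_def)
    then show ?thesis using *[OF \<open>u \<ge> 0\<close>] *[of 0] by (simp add: add.commute)
  qed
  show ?thesis
  proof (cases "s \<le> t")
    case True then show ?thesis using shift[of s "t - s"] assms by simp
  next
    case False then show ?thesis using shift[of t "s - t"] assms by (simp add: mult.commute)
  qed
qed

section \<open>Differentiation\<close>

lemma has_derivative_vec_componentwise:
  fixes f :: "'a::euclidean_space \<Rightarrow> real^'n"
  assumes "\<And>i. ((\<lambda>x. f x $ i) has_derivative (\<lambda>h. f' h $ i)) (at a)"
  shows "(f has_derivative f') (at a)"
  using assms
  by (subst has_derivative_componentwise_within) (auto simp: Basis_vec_def inner_axis)

lemma differentiable_vec_componentwise:
  fixes f :: "'a::euclidean_space \<Rightarrow> real^'n"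
  assumes "\<And>i. (\<lambda>x. f x $ i) differentiable (at a)"
  shows "f differentiable (at a)"
proof -
  obtain f' where "\<And>i. ((\<lambda>x. f x $ i) has_derivative f' i) (at a)"
    using assms unfolding differentiable_def by metis
  then have "(f has_derivative (\<lambda>h. \<chi> i. f' i h)) (at a)"
    by (intro has_derivative_vec_componentwise) simp
  then show ?thesis by (auto simp: differentiable_def)
qed

text \<open>By the Leibniz expansion the determinant is a polynomial in the entries.\<close>

lemma differentiable_det:
  fixes A :: "'a::real_normed_vector \<Rightarrow> real^'n^'n"
  assumes "\<And>i j. (\<lambda>x. A x $ i $ j) differentiable (at a)"
  shows "(\<lambda>x. det (A x)) differentiable (at a)"
proof -
  obtain A' where A': "\<And>i j. ((\<lambda>x. A x $ i $ j) has_derivative A' i j) (at a)"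
    using assms unfolding differentiable_def by metis
  have "(\<lambda>x. \<Prod>i\<in>UNIV. A x $ i $ p i) differentiable (at a)" for p
    unfolding differentiable_def by (rule exI, rule has_derivative_prod, rule A')
  then have "\<forall>p\<in>{p. p permutes UNIV}. (\<lambda>x. of_int (sign p) * (\<Prod>i\<in>UNIV. A x $ i $ p i)) differentiable (at a)"
    by (intro ballI differentiable_mult differentiable_const)
  then show ?thesis
    unfolding det_def by (rule differentiable_sum[OF finite_permutations[OF finite]])
qed

lemma matrix_inv_mult:
  fixes A :: "real^'n^'n"
  assumes "invertible A"
  shows "A ** matrix_inv A = mat 1" "matrix_inv A ** A = mat 1"
  using someI_ex[OF assms[unfolded invertible_def]] by (simp_all add: matrix_inv_def)

text \<open>By Cramer's rule, the solution is locally a quotient of determinants.\<close>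

lemma differentiable_matrix_inv_mult:
  fixes A :: "'a::euclidean_space \<Rightarrow> real^'n^'n" and b :: "'a \<Rightarrow> real^'n"
  assumes U: "open U" "a \<in> U" and inv: "\<And>x. x \<in> U \<Longrightarrow> invertible (A x)"
    and A: "\<And>i j. (\<lambda>x. A x $ i $ j) differentiable (at a)"
    and b: "\<And>i. (\<lambda>x. b x $ i) differentiable (at a)"
  shows "(\<lambda>x. matrix_inv (A x) *v b x) differentiable (at a)"
proof -
  \<comment> \<open>\<open>A x\<close> with its column \<open>k\<close> replaced by
    \<open>b x\<close>.\<close>
  let ?C = "\<lambda>k x. (\<chi> i j. if j = k then b x $ i else A x $ i $ j) :: real^'n^'n"
  have cramer: "matrix_inv (A x) *v b x = (\<chi> k. det (?C k x) / det (A x))" if "x \<in> U" for x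
  proof -
    have "A x *v (matrix_inv (A x) *v b x) = b x"
      using inv[OF that] by (simp add: matrix_vector_mul_assoc matrix_inv_mult)
    then show ?thesis using cramer[of "A x"] inv[OF that] by (simp add: invertible_det_nz)
  qed
  have "(\<lambda>x. \<chi> k. det (?C k x) / det (A x)) differentiable (at a)"
  proof (rule differentiable_vec_componentwise, simp, intro differentiable_divide differentiable_det)
    fix k i j
    show "(\<lambda>x. ?C k x $ i $ j) differentiable (at a)"
      using A b by (cases "j = k") auto
  qed (use A inv[OF U(2)] in \<open>auto simp: invertible_det_nz\<close>)
  \<comment> \<open>The quotient agrees with the solution on \<open>U\<close>, where the determinant
    is nonzero; an open neighbourhood of \<open>a\<close> suffices for the derivative at
    \<open>a\<close>.\<close>
  then show ?thesis
    unfolding differentiable_def using U cramer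
    by (metis (no_types, lifting) has_derivative_transform_within_open)
qed

text \<open>Here \<open>x i\<close> stands for the next observation and \<open>z i\<close> for the
  vector of lagged ones. The derivative is arranged by the factors \<open>e_i z_i\<close> and
  \<open>e_i^2 - v\<close>, which are the two blocks of \<open>H_i\<close>; what multiplies them
  becomes the weight matrix.\<close>

lemma has_derivative_gaussian_log_likelihood:
  fixes \<phi> :: "'a::real_normed_vector \<Rightarrow> 'b::real_inner" and v :: "'a \<Rightarrow> real"
    and x :: "'i \<Rightarrow> real" and z :: "'i \<Rightarrow> 'b"
  defines "e \<equiv> \<lambda>i \<eta>. x i - \<phi> \<eta> \<bullet> z i"
  assumes U: "open U" "\<theta> \<in> U" and pos: "\<And>\<eta>. \<eta> \<in> U \<Longrightarrow> v \<eta> > 0"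
    and \<phi>: "(\<phi> has_derivative \<phi>') (at \<theta>)" and v: "(v has_derivative v') (at \<theta>)"
    and I: "finite I"
  shows "((\<lambda>\<eta>. ln (\<Prod>i\<in>I. 1 / sqrt (2 * pi * v \<eta>) * exp (- (e i \<eta>)\<^sup>2 / (2 * v \<eta>)))) has_derivative
      (\<lambda>h. \<Sum>i\<in>I. e i \<theta> * (\<phi>' h \<bullet> z i) / v \<theta> + ((e i \<theta>)\<^sup>2 - v \<theta>) * v' h / (2 * (v \<theta>)\<^sup>2))) (at \<theta>)"
proof -
  \<comment> \<open>Positivity of \<open>v\<close> on all of \<open>U\<close> makes every factor
    positive there, so the logarithm splits near \<open>\<theta>\<close> and not just at
    \<open>\<theta>\<close>.\<close>
  have ln_eq: "(\<Sum>i\<in>I. - ln (2 * pi * v \<eta>) / 2 - (e i \<eta>)\<^sup>2 / (2 * v \<eta>))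
      = ln (\<Prod>i\<in>I. 1 / sqrt (2 * pi * v \<eta>) * exp (- (e i \<eta>)\<^sup>2 / (2 * v \<eta>)))" if "\<eta> \<in> U" for \<eta>
  proof -
    have w: "2 * pi * v \<eta> > 0" using pos[OF that] by simp
    have factor: "ln (1 / sqrt w * exp x) = - ln w / 2 + x" if "w > 0" for w x :: real
    proof -
      have "ln (1 / sqrt w * exp x) = ln (1 / sqrt w) + ln (exp x)"
        using that by (intro ln_mult_pos) simp_all
      then show ?thesis using that by (simp add: ln_div ln_sqrt)
    qed
    have nonzero: "1 / sqrt w * exp x \<noteq> 0" if "w > 0" for w x :: real
      using that by simp
    have "ln (\<Prod>i\<in>I. 1 / sqrt (2 * pi * v \<eta>) * exp (- (e i \<eta>)\<^sup>2 / (2 * v \<eta>)))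
        = (\<Sum>i\<in>I. ln (1 / sqrt (2 * pi * v \<eta>) * exp (- (e i \<eta>)\<^sup>2 / (2 * v \<eta>))))"
      by (rule ln_prod[OF I nonzero[OF w]])
    then show ?thesis by (simp only: factor[OF w] minus_divide_left[symmetric] diff_conv_add_uminus)
  qed
  have e: "(e i has_derivative (\<lambda>h. - (\<phi>' h \<bullet> z i))) (at \<theta>)" for i
    unfolding e_def by (auto intro!: derivative_eq_intros \<phi>)
  have "((\<lambda>\<eta>. - ln (2 * pi * v \<eta>) / 2 - (e i \<eta>)\<^sup>2 / (2 * v \<eta>)) has_derivative
      (\<lambda>h. e i \<theta> * (\<phi>' h \<bullet> z i) / v \<theta> + ((e i \<theta>)\<^sup>2 - v \<theta>) * v' h / (2 * (v \<theta>)\<^sup>2))) (at \<theta>)" for i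
  proof -
    have p: "v \<theta> > 0" using pos[OF U(2)] .
    have w: "2 * pi * v \<theta> > 0" using p by simp
    have 1: "((\<lambda>\<eta>. ln (2 * pi * v \<eta>)) has_derivative (\<lambda>h. v' h / v \<theta>)) (at \<theta>)"
      by (rule has_derivative_eq_rhs[OF has_derivative_ln[OF w has_derivative_mult_right[OF v, of "2 * pi"]]])
        (use p in \<open>simp add: fun_eq_iff field_simps\<close>)
    have 2: "((\<lambda>\<eta>. (e i \<eta>)\<^sup>2 / (2 * v \<eta>)) has_derivative
        (\<lambda>h. (- 2 * e i \<theta> * (\<phi>' h \<bullet> z i) * (2 * v \<theta>) - (e i \<theta>)\<^sup>2 * (2 * v' h)) / (2 * v \<theta> * (2 * v \<theta>)))) (at \<theta>)"
      by (rule has_derivative_eq_rhs[OF has_derivative_divide'[OF has_derivative_power[OF e]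
            has_derivative_mult_right[OF v]]])
        (use p in \<open>simp_all add: fun_eq_iff\<close>)
    \<comment> \<open>The normalizing factor contributes \<open>- v' / (2 v)\<close> and the
      exponent \<open>e^2 v' / (2 v^2)\<close>; together they give the centred form
      \<open>(e^2 - v) v' / (2 v^2)\<close>.\<close>
    have "- (v' h / v \<theta>) / 2 - (- 2 * e i \<theta> * (\<phi>' h \<bullet> z i) * (2 * v \<theta>) - (e i \<theta>)\<^sup>2 * (2 * v' h)) / (2 * v \<theta> * (2 * v \<theta>))
       = e i \<theta> * (\<phi>' h \<bullet> z i) / v \<theta> + ((e i \<theta>)\<^sup>2 - v \<theta>) * v' h / (2 * (v \<theta>)\<^sup>2)" for h
    proof -
      have "- (b / w) / 2 - (- 2 * x * c * (2 * w) - x\<^sup>2 * (2 * b)) / (2 * w * (2 * w))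
        = x * c / w + (x\<^sup>2 - w) * b / (2 * w\<^sup>2)" if "w > 0" for b c w x :: real
        using that by (simp add: divide_simps power2_eq_square) (simp add: algebra_simps)
      then show ?thesis using p .
    qed
    then show ?thesis
      by (intro has_derivative_eq_rhs[OF has_derivative_diff[OF
            bounded_linear.has_derivative[OF bounded_linear_divide has_derivative_minus[OF 1]] 2]]) (simp add: fun_eq_iff)
  qed
  then have "((\<lambda>\<eta>. \<Sum>i\<in>I. - ln (2 * pi * v \<eta>) / 2 - (e i \<eta>)\<^sup>2 / (2 * v \<eta>)) has_derivative
      (\<lambda>h. \<Sum>i\<in>I. e i \<theta> * (\<phi>' h \<bullet> z i) / v \<theta> + ((e i \<theta>)\<^sup>2 - v \<theta>) * v' h / (2 * (v \<theta>)\<^sup>2))) (at \<theta>)"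
    by (rule has_derivative_sum)
  then show ?thesis
    by (rule has_derivative_transform_within_open[OF _ U ln_eq])
qed

section \<open>Block matrices\<close>

lemma sum_UNIV_plus:
  "(\<Sum>i\<in>UNIV. f i) = (\<Sum>i\<in>(UNIV::'a::finite set). f (Inl i)) + (\<Sum>i\<in>(UNIV::'b::finite set). f (Inr i))"
  by (subst UNIV_Plus_UNIV[symmetric], subst sum.Plus) auto

lemma hcat_mult_vcat: "hcat A B ** vcat C D = A ** C + B ** D"
  by (simp add: vec_eq_iff hcat_def vcat_def matrix_matrix_mult_def sum_UNIV_plus)

lemma mult_hcat: "A ** hcat B C = hcat (A ** B) (A ** C)"
  by (auto simp: vec_eq_iff hcat_def matrix_matrix_mult_def split: sum.split)

lemma vcat_mult: "vcat A B ** C = vcat (A ** C) (B ** C)"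
  by (auto simp: vec_eq_iff vcat_def matrix_matrix_mult_def split: sum.split)

lemma hcat_add: "hcat A B + hcat C D = hcat (A + C) (B + D)"
  by (auto simp: vec_eq_iff hcat_def split: sum.split)

lemma hcat_mult_append_scalar:
  "hcat A B *v append_scalar x y = A *v x + B *v vec y"
  by (simp add: vec_eq_iff hcat_def append_scalar_def matrix_vector_mult_def sum_UNIV_plus)

lemma transpose_vcat: "transpose (vcat A B) = hcat (transpose A) (transpose B)"
  by (auto simp: vec_eq_iff vcat_def hcat_def transpose_def split: sum.split)

lemma mat_1_eq_blocks: "mat 1 = vcat (hcat (mat 1) 0) (hcat 0 (mat 1))"
  by (auto simp: vec_eq_iff vcat_def hcat_def mat_def split: sum.split)

text \<open>The block diagonal matrix of the inverses is a right inverse, which is enough for a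
  square matrix.\<close>

lemma invertible_block_diag:
  fixes A :: "real^'a^'a" and B :: "real^'b^'b"
  assumes "invertible A" "invertible B"
  shows "invertible (vcat (hcat A 0) (hcat 0 B))"
proof -
  have "vcat (hcat A 0) (hcat 0 B) ** vcat (hcat (matrix_inv A) 0) (hcat 0 (matrix_inv B)) = mat 1"
    using assms
    by (simp add: vcat_mult hcat_mult_vcat mult_hcat hcat_add matrix_inv_mult mat_1_eq_blocks)
  then show ?thesis by (auto simp: invertible_right_inverse)
qed

section \<open>Signs, entries of outer products and derivatives, and componentwise
  integration\<close>

lemma transpose_uminus: "transpose (- A) = - transpose (A :: real^'m^'n)"
  by (simp add: transpose_def vec_eq_iff)

lemma matrix_uminus_mult: "- A ** B = - (A ** (B :: real^'l^'m) :: real^'l^'n)"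
  by (simp add: matrix_matrix_mult_def vec_eq_iff sum_negf)

lemma outer_nth: "outer x $ a $ b = x $ a * x $ b"
  by (simp add: outer_def columnvector_def rowvector_def matrix_matrix_mult_def)

lemma jacobian_nth:
  assumes "(f has_derivative f') (at x)"
  shows "jacobian f (at x) $ a $ b = f' (axis b 1) $ a"
  by (simp add: jacobian_def matrix_def frechet_derivative_at[OF assms])

lemma grad_nth:
  assumes "(f has_derivative f') (at x)"
  shows "grad f x $ b = f' (axis b 1)"
  by (simp add: grad_def frechet_derivative_at[OF assms])

text \<open>\<open>autocov\<close> depends on its time argument only through the absolute
  value.\<close>

lemma Kmat_transpose: "transpose (Kmat lag \<Delta> (autocov P X) \<theta>) = Kmat lag \<Delta> (autocov P X) \<theta>"
  by (simp add: Kmat_def transpose_def vec_eq_iff autocov_def abs_minus_commute flip: left_diff_distrib)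
    (simp add: abs_mult abs_minus_commute)

text \<open>A vector is the sum of its components, each embedded by the bounded linear map
  \<open>axis i\<close>. The component type may itself be a vector type, so two applications reduce
  the integral of a matrix to its entries.\<close>

lemma has_bochner_integral_vec:
  fixes f :: "'w \<Rightarrow> 'b::euclidean_space^'n"
  assumes "\<And>i. has_bochner_integral M (\<lambda>\<omega>. f \<omega> $ i) (x $ i)"
  shows "has_bochner_integral M f x"
proof -
  have ax: "bounded_linear (axis i :: 'b \<Rightarrow> 'b^'n)" for i
    by (rule linear_conv_bounded_linear[THEN iffD1])
      (rule linearI; simp add: vec_eq_iff axis_def)
  have decomp: "(\<Sum>i\<in>UNIV. axis i (y $ i)) = y" for y :: "'b^'n"
    by (simp add: vec_eq_iff axis_def)
  have "has_bochner_integral M (\<lambda>\<omega>. \<Sum>i\<in>UNIV. axis i (f \<omega> $ i)) (\<Sum>i\<in>UNIV. axis i (x $ i))"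
    by (intro has_bochner_integral_sum has_bochner_integral_bounded_linear[OF ax] assms)
  then show ?thesis by (simp only: decomp)
qed

section \<open>Moments of the prediction errors\<close>

text \<open>The index \<open>i \<ge> CARD('k)\<close> stays arbitrary: the sensitivity is needed for
  every such \<open>i\<close>, while \<open>M1\<close> is the case
  \<open>i = CARD('k)\<close>.\<close>

context
  fixes lag :: "'k::finite \<Rightarrow> nat" and \<Delta> :: real and P :: "real^'p \<Rightarrow> 'w measure"
    and X :: "real \<Rightarrow> 'w \<Rightarrow> real" and \<theta> :: "real^'p" and r :: real and i :: nat
  assumes lag: "bij_betw lag UNIV {1..CARD('k)}" and \<Delta>: "\<Delta> > 0" and i: "i \<ge> CARD('k)"
    and prob: "prob_space (P \<theta>)" and r: "r \<ge> 0"
    and stat: "stationary_process (P \<theta>) {-r..} X"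
    and gauss: "centred_gaussian_process (P \<theta>) {-r..} X"
    and inv: "invertible (Kmat lag \<Delta> (autocov P X) \<theta>)"
  fixes M K Z e N
  defines "M \<equiv> P \<theta>" and "K \<equiv> autocov P X"
    and "Z \<equiv> \<lambda>j \<omega>. lagged lag \<Delta> X i \<omega> $ j" and "e \<equiv> pred_error lag \<Delta> (autocov P X) X i \<theta>"
    and "N \<equiv> X (real (i + 1) * \<Delta>)"
begin

interpretation prob_space "P \<theta>" by (rule prob)

lemma gaussian: "centred_gaussian_process M {-r..} X"
  using gauss by (simp add: M_def)

text \<open>This makes the natural number subtraction in \<open>i + 1 - lag j\<close> exact.\<close>

lemma lag_le: "lag j \<le> i"
  using bij_betw_imp_surj_on[OF lag] i by (metis atLeastAtMost_iff le_trans rangeI)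

lemma second_moment: "s \<ge> 0 \<Longrightarrow> t \<ge> 0 \<Longrightarrow> (\<integral>\<omega>. X s \<omega> * X t \<omega> \<partial>M) = K \<theta> (s - t)"
  unfolding autocov_def K_def M_def by (rule stationary_second_moment[OF stat r])

lemma observation_time_ge: "- r \<le> real m * \<Delta>"
proof -
  have "real m * \<Delta> \<ge> 0" using \<Delta> by simp
  then show ?thesis using r by linarith
qed

lemma lagged_lincomb: "Z j \<in> lincomb {-r..} X"
  by (simp add: Z_def lagged_def lincomb_base observation_time_ge del: of_nat_diff)

lemma next_lincomb: "N \<in> lincomb {-r..} X"
  by (simp add: N_def lincomb_base observation_time_ge del: of_nat_add of_nat_Suc)

lemma pred_error_eq: "e \<omega> = N \<omega> - (\<Sum>j\<in>UNIV. phi lag \<Delta> K \<theta> $ j * Z j \<omega>)"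
  by (simp add: pred_error_def inner_vec_def e_def N_def Z_def K_def)

lemma pred_error_lincomb: "e \<in> lincomb {-r..} X"
proof -
  have "(\<lambda>\<omega>. 1 * N \<omega> + (-1) * (\<Sum>j\<in>UNIV. phi lag \<Delta> K \<theta> $ j * Z j \<omega>)) \<in> lincomb {-r..} X"
    by (intro next_lincomb lagged_lincomb lincomb_lin lincomb_sum)
  then show ?thesis by (simp add: pred_error_eq[abs_def])
qed

section \<open>Covariances of observations and prediction errors\<close>

lemma cov_lagged: "(\<integral>\<omega>. Z l \<omega> * Z m \<omega> \<partial>M) = Kmat lag \<Delta> K \<theta> $ l $ m"
proof -
  \<comment> \<open>Larger lags mean earlier times, so the lags appear in reversed order; this gives
    the transpose, and symmetry of the matrix removes it.\<close>
  have "real (i + 1 - lag l) * \<Delta> - real (i + 1 - lag m) * \<Delta> = (real (lag m) - real (lag l)) * \<Delta>"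
    using lag_le[of l] lag_le[of m] by (simp add: of_nat_diff algebra_simps)
  then have "(\<integral>\<omega>. Z l \<omega> * Z m \<omega> \<partial>M) = transpose (Kmat lag \<Delta> K \<theta>) $ l $ m"
    using \<Delta> by (simp add: Z_def lagged_def second_moment Kmat_def transpose_def)
  then show ?thesis by (simp only: Kmat_transpose K_def)
qed

lemma cov_next: "(\<integral>\<omega>. N \<omega> * Z l \<omega> \<partial>M) = kappa lag \<Delta> K \<theta> $ l"
proof -
  have "real (i + 1) * \<Delta> - real (i + 1 - lag l) * \<Delta> = real (lag l) * \<Delta>"
    using lag_le[of l] by (simp add: of_nat_diff algebra_simps)
  then show ?thesis
    using \<Delta> second_moment[of "real (i + 1) * \<Delta>" "real (i + 1 - lag l) * \<Delta>"]
    by (simp add: Z_def N_def lagged_def kappa_def)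
qed

lemma pred_error_cov:
  assumes "V \<in> lincomb {-r..} X"
  shows "(\<integral>\<omega>. e \<omega> * V \<omega> \<partial>M)
    = (\<integral>\<omega>. N \<omega> * V \<omega> \<partial>M) - (\<Sum>j\<in>UNIV. phi lag \<Delta> K \<theta> $ j * (\<integral>\<omega>. Z j \<omega> * V \<omega> \<partial>M))"
proof -
  have "(\<integral>\<omega>. e \<omega> * V \<omega> \<partial>M)
      = (\<integral>\<omega>. N \<omega> * V \<omega> - (\<Sum>j\<in>UNIV. phi lag \<Delta> K \<theta> $ j * (Z j \<omega> * V \<omega>)) \<partial>M)"
    by (simp only: pred_error_eq left_diff_distrib sum_distrib_right mult.assoc)
  then show ?thesis
    using assms next_lincomb lagged_lincomb gaussian_integrable_mult[OF gaussian]
    by simp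
qed

text \<open>These are the normal equations of the projection: multiplying \<open>phi\<close> by the
  covariance matrix returns \<open>kappa\<close>, because the matrix is invertible. Its symmetry
  moves the summation to the first index.\<close>

lemma pred_error_orthogonal: "(\<integral>\<omega>. e \<omega> * Z l \<omega> \<partial>M) = 0"
proof -
  have "Kmat lag \<Delta> K \<theta> *v phi lag \<Delta> K \<theta> = kappa lag \<Delta> K \<theta>"
    using inv by (simp add: K_def phi_def matrix_vector_mul_assoc matrix_inv_mult)
  then have "transpose (Kmat lag \<Delta> K \<theta>) *v phi lag \<Delta> K \<theta> = kappa lag \<Delta> K \<theta>"
    by (simp only: Kmat_transpose K_def)
  then have "(\<Sum>j\<in>UNIV. phi lag \<Delta> K \<theta> $ j * Kmat lag \<Delta> K \<theta> $ j $ l) = kappa lag \<Delta> K \<theta> $ l"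
    by (simp add: vec_eq_iff matrix_vector_mult_def transpose_def mult.commute)
  then show ?thesis
    by (simp only: pred_error_cov[OF lagged_lincomb] cov_lagged cov_next)
qed

text \<open>The predictor is a combination of the \<open>Z j\<close>, to which \<open>e\<close> is
  orthogonal. Hence \<open>E e^2 = E e N\<close>, and expanding \<open>e\<close> once more gives the
  variance of \<open>N\<close> minus the inner product of \<open>phi\<close> and
  \<open>kappa\<close>.\<close>

lemma pred_error_second_moment: "(\<integral>\<omega>. (e \<omega>)\<^sup>2 \<partial>M) = pvar lag \<Delta> K \<theta>"
proof -
  have 0: "(\<integral>\<omega>. Z j \<omega> * e \<omega> \<partial>M) = 0" for j
    using pred_error_orthogonal[of j] by (simp only: mult.commute)
  have "(\<integral>\<omega>. (e \<omega>)\<^sup>2 \<partial>M) = (\<integral>\<omega>. e \<omega> * N \<omega> \<partial>M)"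
    using pred_error_cov[OF pred_error_lincomb]
    by (simp only: power2_eq_square 0) (simp add: mult.commute)
  also have "\<dots> = (\<integral>\<omega>. N \<omega> * N \<omega> \<partial>M) - (\<Sum>j\<in>UNIV. phi lag \<Delta> K \<theta> $ j * (\<integral>\<omega>. N \<omega> * Z j \<omega> \<partial>M))"
    unfolding pred_error_cov[OF next_lincomb] by (simp add: mult.commute)
  also have "\<dots> = pvar lag \<Delta> K \<theta>"
    using \<Delta> unfolding cov_next
    by (simp add: N_def second_moment pvar_def phi_def inner_vec_def mult.commute del: of_nat_add of_nat_Suc)
  finally show ?thesis .
qed

section \<open>Expectations of the outer product and of the Jacobian of \<open>H_i\<close>\<close>

lemma pred_error_mult_lagged: "has_bochner_integral M (\<lambda>\<omega>. e \<omega> * Z l \<omega>) 0"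
  using gaussian_integrable_mult[OF gaussian pred_error_lincomb lagged_lincomb] pred_error_orthogonal
  by (simp add: has_bochner_integral_iff)

lemma pred_error_power2: "has_bochner_integral M (\<lambda>\<omega>. (e \<omega>)\<^sup>2) (pvar lag \<Delta> K \<theta>)"
  using gaussian_integrable_power2[OF gaussian pred_error_lincomb] pred_error_second_moment
  by (simp add: has_bochner_integral_iff)

lemma has_bochner_integral_const: "has_bochner_integral M (\<lambda>\<omega>. c) (c::real)"
  by (simp add: has_bochner_integral_iff prob_space M_def)

text \<open>Joint normality and the orthogonality of \<open>e\<close> to all \<open>Z l\<close> make
  the fourth moments factor. In the upper left block \<open>E e^2 Z_l Z_m\<close> becomes
  \<open>v\<close> times the covariance of \<open>Z_l\<close> and \<open>Z_m\<close>.\<close>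

lemma outer_Hvec_integral:
  defines "v \<equiv> pvar lag \<Delta> K \<theta>"
  shows "has_bochner_integral M (\<lambda>\<omega>. outer (Hvec lag \<Delta> K X i \<theta> \<omega>))
    (vcat (hcat (v *\<^sub>R Kmat lag \<Delta> K \<theta>) (0 :: real^1^'k)) (hcat (0 :: real^'k^1) (mat (2 * v\<^sup>2) :: real^1^1)))"
proof -
  have LL: "has_bochner_integral M (\<lambda>\<omega>. (e \<omega> * Z l \<omega>) * (e \<omega> * Z m \<omega>)) (v * Kmat lag \<Delta> K \<theta> $ l $ m)" for l m
    using gaussian_moment_211[OF gaussian pred_error_lincomb lagged_lincomb lagged_lincomb
        pred_error_orthogonal pred_error_orthogonal, of l m]
    unfolding pred_error_second_moment cov_lagged v_def
    by (simp add: power2_eq_square ac_simps)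
  have LR: "has_bochner_integral M (\<lambda>\<omega>. (e \<omega> * Z l \<omega>) * ((e \<omega>)\<^sup>2 - v)) 0" for l
  proof -
    \<comment> \<open>Both terms of the expansion have mean zero, since
      \<open>E e^3 Z_l = 3 E e^2 E e Z_l\<close> and \<open>E e Z_l = 0\<close>.\<close>
    have "has_bochner_integral M (\<lambda>\<omega>. (e \<omega>)^3 * Z l \<omega> - v * (e \<omega> * Z l \<omega>))
       (3 * (\<integral>\<omega>. (e \<omega>)\<^sup>2 \<partial>M) * (\<integral>\<omega>. e \<omega> * Z l \<omega> \<partial>M) - v * 0)"
      by (intro has_bochner_integral_diff has_bochner_integral_mult_right pred_error_mult_lagged
          gaussian_moment_31[OF gaussian] pred_error_lincomb lagged_lincomb)
    then show ?thesis
      by (simp add: pred_error_orthogonal power2_eq_square power3_eq_cube algebra_simps)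
  qed
  have RR: "has_bochner_integral M (\<lambda>\<omega>. ((e \<omega>)\<^sup>2 - v) * ((e \<omega>)\<^sup>2 - v)) (2 * v\<^sup>2)"
  proof -
    \<comment> \<open>The variance of \<open>e^2\<close>: the fourth moment \<open>3 v^2\<close>,
      then \<open>- 2 v^2 + v^2\<close> from expanding the square.\<close>
    have "has_bochner_integral M (\<lambda>\<omega>. (e \<omega>)^4 - 2 * v * (e \<omega>)\<^sup>2 + v\<^sup>2)
       (3 * (\<integral>\<omega>. (e \<omega>)\<^sup>2 \<partial>M)\<^sup>2 - 2 * v * v + v\<^sup>2)"
      unfolding v_def
      by (intro has_bochner_integral_diff has_bochner_integral_add has_bochner_integral_mult_right
          pred_error_power2 gaussian_power4[OF gaussian] pred_error_lincomb has_bochner_integral_const)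
    moreover have "(\<lambda>\<omega>. (e \<omega>)^4 - 2 * v * (e \<omega>)\<^sup>2 + v\<^sup>2) = (\<lambda>\<omega>. ((e \<omega>)\<^sup>2 - v) * ((e \<omega>)\<^sup>2 - v))"
      by (simp add: fun_eq_iff power2_eq_square power4_eq_xxxx algebra_simps)
    moreover have "3 * (\<integral>\<omega>. (e \<omega>)\<^sup>2 \<partial>M)\<^sup>2 - 2 * v * v + v\<^sup>2 = 2 * v\<^sup>2"
      unfolding pred_error_second_moment v_def by (simp add: power2_eq_square)
    ultimately show ?thesis by (simp only:)
  qed
  have RL: "has_bochner_integral M (\<lambda>\<omega>. ((e \<omega>)\<^sup>2 - v) * (e \<omega> * Z l \<omega>)) 0" for l
    using LR[of l] by (simp only: mult.commute)
  show ?thesis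
  proof (intro has_bochner_integral_vec)
    fix a b :: "'k + 1"
    show "has_bochner_integral M (\<lambda>\<omega>. outer (Hvec lag \<Delta> K X i \<theta> \<omega>) $ a $ b)
      (vcat (hcat (v *\<^sub>R Kmat lag \<Delta> K \<theta>) (0 :: real^1^'k)) (hcat (0 :: real^'k^1) (mat (2 * v\<^sup>2) :: real^1^1)) $ a $ b)"
      using LL LR RL RR
      by (cases a; cases b)
        (simp_all add: e_def Z_def K_def outer_nth num1_eq_iff Hvec_def append_scalar_def vcat_def hcat_def mat_def v_def)
  qed
qed

text \<open>The observations do not depend on the parameter, so \<open>e\<close> contributes the
  derivative \<open>- (\<phi>' h \<bullet> Z)\<close>. In the upper block the mean of
  \<open>- (\<phi>' h \<bullet> Z) Z\<close> brings in the covariance matrix of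
  \<open>Z\<close>.\<close>

lemma jacobian_Hvec_integral:
  assumes \<phi>: "phi lag \<Delta> K differentiable (at \<theta>)" and v: "pvar lag \<Delta> K differentiable (at \<theta>)"
  shows "(\<lambda>\<eta>. Hvec lag \<Delta> K X i \<eta> \<omega>) differentiable (at \<theta>)"
    and "has_bochner_integral M (\<lambda>\<omega>. jacobian (\<lambda>\<eta>. Hvec lag \<Delta> K X i \<eta> \<omega>) (at \<theta>))
      (- vcat (Kmat lag \<Delta> K \<theta> ** jacobian (phi lag \<Delta> K) (at \<theta>)) (rowvector (grad (pvar lag \<Delta> K) \<theta>) :: real^'p^1))"
proof -
  obtain \<phi>' v' where \<phi>': "(phi lag \<Delta> K has_derivative \<phi>') (at \<theta>)"
    and v': "(pvar lag \<Delta> K has_derivative v') (at \<theta>)"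
    using \<phi> v by (auto simp: differentiable_def)
  have e': "((\<lambda>\<eta>. pred_error lag \<Delta> K X i \<eta> \<omega>) has_derivative
      (\<lambda>h. - (\<phi>' h \<bullet> lagged lag \<Delta> X i \<omega>))) (at \<theta>)" for \<omega>
    unfolding pred_error_def by (auto intro!: derivative_eq_intros \<phi>')
  have H': "((\<lambda>\<eta>. Hvec lag \<Delta> K X i \<eta> \<omega>) has_derivative
      (\<lambda>h. append_scalar (- (\<phi>' h \<bullet> lagged lag \<Delta> X i \<omega>) *\<^sub>R lagged lag \<Delta> X i \<omega>)
          (- 2 * e \<omega> * (\<phi>' h \<bullet> lagged lag \<Delta> X i \<omega>) - v' h))) (at \<theta>)" for \<omega>
  proof (rule has_derivative_vec_componentwise)
    fix a :: "'k + 1"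
    show "((\<lambda>\<eta>. Hvec lag \<Delta> K X i \<eta> \<omega> $ a) has_derivative
      (\<lambda>h. append_scalar (- (\<phi>' h \<bullet> lagged lag \<Delta> X i \<omega>) *\<^sub>R lagged lag \<Delta> X i \<omega>)
          (- 2 * e \<omega> * (\<phi>' h \<bullet> lagged lag \<Delta> X i \<omega>) - v' h) $ a)) (at \<theta>)"
      by (cases a) (auto simp: e_def K_def[symmetric] Hvec_def append_scalar_def intro!: derivative_eq_intros e' v')
  qed
  then show "(\<lambda>\<eta>. Hvec lag \<Delta> K X i \<eta> \<omega>) differentiable (at \<theta>)"
    by (auto simp: differentiable_def)
  have top: "has_bochner_integral M (\<lambda>\<omega>. - (\<phi>' h \<bullet> lagged lag \<Delta> X i \<omega>) * Z l \<omega>)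
     (- (\<Sum>m\<in>UNIV. Kmat lag \<Delta> K \<theta> $ l $ m * \<phi>' h $ m))" for l h
  proof -
    have "has_bochner_integral M (\<lambda>\<omega>. \<Sum>m\<in>UNIV. - \<phi>' h $ m * (Z l \<omega> * Z m \<omega>))
       (\<Sum>m\<in>UNIV. - \<phi>' h $ m * Kmat lag \<Delta> K \<theta> $ l $ m)"
      unfolding cov_lagged[symmetric]
      by (intro has_bochner_integral_sum has_bochner_integral_mult_right has_bochner_integral_integrable
          gaussian_integrable_mult[OF gaussian] lagged_lincomb)
    then show ?thesis
      by (simp add: Z_def inner_vec_def sum_distrib_left sum_distrib_right sum_negf ac_simps)
  qed
  \<comment> \<open>Differentiating \<open>e^2\<close> leaves a combination of products
    \<open>e Z_m\<close>, all of mean zero, so only the derivative of \<open>- v\<close>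
    survives.\<close>
  have bot: "has_bochner_integral M (\<lambda>\<omega>. - 2 * e \<omega> * (\<phi>' h \<bullet> lagged lag \<Delta> X i \<omega>) - v' h) (- v' h)" for h
  proof -
    have "has_bochner_integral M (\<lambda>\<omega>. (\<Sum>m\<in>UNIV. (- 2 * \<phi>' h $ m) * (e \<omega> * Z m \<omega>)) - v' h)
       ((\<Sum>m\<in>UNIV. (- 2 * \<phi>' h $ m) * 0) - v' h)"
      by (intro has_bochner_integral_diff has_bochner_integral_sum has_bochner_integral_mult_right
          pred_error_mult_lagged has_bochner_integral_const)
    then show ?thesis
      by (simp add: Z_def inner_vec_def sum_distrib_left ac_simps)
  qed
  show "has_bochner_integral M (\<lambda>\<omega>. jacobian (\<lambda>\<eta>. Hvec lag \<Delta> K X i \<eta> \<omega>) (at \<theta>))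
      (- vcat (Kmat lag \<Delta> K \<theta> ** jacobian (phi lag \<Delta> K) (at \<theta>)) (rowvector (grad (pvar lag \<Delta> K) \<theta>) :: real^'p^1))"
  proof (intro has_bochner_integral_vec)
    fix a :: "'k + 1" and b :: 'p
    show "has_bochner_integral M (\<lambda>\<omega>. jacobian (\<lambda>\<eta>. Hvec lag \<Delta> K X i \<eta> \<omega>) (at \<theta>) $ a $ b)
      ((- vcat (Kmat lag \<Delta> K \<theta> ** jacobian (phi lag \<Delta> K) (at \<theta>)) (rowvector (grad (pvar lag \<Delta> K) \<theta>) :: real^'p^1)) $ a $ b)"
      using top bot
      by (cases a)
        (simp_all add: Z_def jacobian_nth[OF H'] append_scalar_def vcat_def rowvector_def
          grad_nth[OF v'] matrix_matrix_mult_def jacobian_nth[OF \<phi>'])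
  qed
qed

end

section \<open>The pseudo-score\<close>

text \<open>A pathwise identity: it is an application of calculus for each fixed
  \<open>\<omega>\<close>, and no distributional property enters.\<close>

lemma pseudo_score_eq:
  fixes lag :: "'k::finite \<Rightarrow> nat" and K :: "real^'p \<Rightarrow> real \<Rightarrow> real"
  assumes U: "open U" "\<theta> \<in> U" and pos: "\<And>\<eta>. \<eta> \<in> U \<Longrightarrow> pvar lag \<Delta> K \<eta> > 0"
    and \<phi>: "phi lag \<Delta> K differentiable (at \<theta>)" and v: "pvar lag \<Delta> K differentiable (at \<theta>)"
  shows "(\<lambda>\<eta>. ln (pseudo_likelihood lag \<Delta> K X n \<eta> \<omega>)) differentiable (at \<theta>)"
    and "pseudo_score lag \<Delta> K X n \<theta> \<omega>
      = Atilde lag \<Delta> K \<theta> *v (\<Sum>i = CARD('k)..<n. Hvec lag \<Delta> K X i \<theta> \<omega>)"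
proof -
  obtain \<phi>' v' where \<phi>': "(phi lag \<Delta> K has_derivative \<phi>') (at \<theta>)"
    and v': "(pvar lag \<Delta> K has_derivative v') (at \<theta>)"
    using \<phi> v by (auto simp: differentiable_def)
  have D: "((\<lambda>\<eta>. ln (pseudo_likelihood lag \<Delta> K X n \<eta> \<omega>)) has_derivative
      (\<lambda>h. \<Sum>i = CARD('k)..<n. pred_error lag \<Delta> K X i \<theta> \<omega> * (\<phi>' h \<bullet> lagged lag \<Delta> X i \<omega>) / pvar lag \<Delta> K \<theta>
        + ((pred_error lag \<Delta> K X i \<theta> \<omega>)\<^sup>2 - pvar lag \<Delta> K \<theta>) * v' h / (2 * (pvar lag \<Delta> K \<theta>)\<^sup>2))) (at \<theta>)"
    unfolding pseudo_likelihood_def pred_error_def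
    by (rule has_derivative_gaussian_log_likelihood[OF U pos \<phi>' v']) auto
  then show "(\<lambda>\<eta>. ln (pseudo_likelihood lag \<Delta> K X n \<eta> \<omega>)) differentiable (at \<theta>)"
    by (auto simp: differentiable_def)
  show "pseudo_score lag \<Delta> K X n \<theta> \<omega>
      = Atilde lag \<Delta> K \<theta> *v (\<Sum>i = CARD('k)..<n. Hvec lag \<Delta> K X i \<theta> \<omega>)"
    \<comment> \<open>The weight matrix is moved inside the sum by linearity and then acts on the
      two blocks of each \<open>H_i\<close>; the result is compared with the derivative
      \<open>D\<close> in the coordinate directions.\<close>
    unfolding pseudo_score_def linear_sum[OF matrix_vector_mul_linear] Atilde_def Hvec_def
      hcat_mult_append_scalar
    by (simp add: vec_eq_iff grad_nth[OF D] grad_nth[OF v'] 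
        matrix_vector_mult_def transpose_def jacobian_nth[OF \<phi>'] columnvector_def inner_vec_def
        sum_distrib_left sum_divide_distrib sum.distrib ac_simps)
qed

text \<open>\<open>phi\<close> solves a linear system with differentiable entries, which is
  invertible on a neighbourhood of \<open>\<theta>\<close> as Cramer's rule requires;
  \<open>pvar\<close> is then built from \<open>phi\<close> by an inner product.\<close>

lemma differentiable_phi_pvar:
  fixes lag :: "'k::finite \<Rightarrow> nat" and K :: "real^'p \<Rightarrow> real \<Rightarrow> real"
  assumes U: "open U" "\<theta> \<in> U" and inv: "\<And>\<eta>. \<eta> \<in> U \<Longrightarrow> invertible (Kmat lag \<Delta> K \<eta>)"
    and K: "\<And>t. (\<lambda>\<eta>. K \<eta> t) differentiable (at \<theta>)"
  shows "phi lag \<Delta> K differentiable (at \<theta>)" and "pvar lag \<Delta> K differentiable (at \<theta>)"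
proof -
  show \<phi>: "phi lag \<Delta> K differentiable (at \<theta>)"
    unfolding phi_def[abs_def]
    by (rule differentiable_matrix_inv_mult[OF U inv]) (simp_all add: Kmat_def kappa_def K)
  have "kappa lag \<Delta> K differentiable (at \<theta>)"
    by (rule differentiable_vec_componentwise) (simp add: kappa_def K)
  then have "(\<lambda>\<eta>. K \<eta> 0 - kappa lag \<Delta> K \<eta> \<bullet> phi lag \<Delta> K \<eta>) differentiable (at \<theta>)"
    using \<phi> K by (intro differentiable_diff differentiable_inner)
  then show "pvar lag \<Delta> K differentiable (at \<theta>)"
    by (simp add: pvar_def[abs_def] phi_def)
qed

text \<open>Derivatives \<open>at \<theta>\<close> involve a full neighbourhood, hence the
  restriction to \<open>interior \<Theta>\<close>. The clauses on differentiability, integrability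
  and invertibility ensure that the gradients, Jacobians, Bochner integrals and inverse are genuine
  and not default values.\<close>

theorem mainTheorem4:
  fixes \<Theta> :: "(real^'p) set"
    and P :: "real^'p \<Rightarrow> 'w measure"
    and X :: "real \<Rightarrow> 'w \<Rightarrow> real"
    and r \<sigma> :: "real^'p \<Rightarrow> real"
    and a :: "real^'p \<Rightarrow> real measure \<times> real measure"
    and lag :: "'k::finite \<Rightarrow> nat"
    and \<Delta> :: real
    and n :: nat
  defines "K \<equiv> autocov P X"
    and "H \<equiv> Hvec lag \<Delta> (autocov P X) X"
    and "\<phi> \<equiv> phi lag \<Delta> (autocov P X)"
    and "v \<equiv> pvar lag \<Delta> (autocov P X)"
    and "\<K> \<equiv> Kmat lag \<Delta> (autocov P X)"
  assumes lag: "bij_betw lag UNIV {1..CARD('k)}"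
    and \<Delta>: "\<Delta> > 0"
    and n: "n > CARD('k)"
    and model: "gaussian_sdde_model \<Theta> P r a \<sigma> X"
    and nondegenerate: "\<And>\<theta>. \<theta> \<in> \<Theta> \<Longrightarrow> invertible (\<K> \<theta>) \<and> v \<theta> > 0"
    and smooth: "\<And>t. continuously_differentiable_on (\<lambda>\<theta>. K \<theta> t) (interior \<Theta>)"
  shows "prediction_based_estimating_function lag \<Delta> K X n (interior \<Theta>) (\<Union>\<theta>\<in>\<Theta>. space (P \<theta>))
           (pseudo_score lag \<Delta> K X n)
    \<and> (\<forall>\<theta>\<in>interior \<Theta>.
         \<phi> differentiable (at \<theta>) \<and> v differentiable (at \<theta>)
       \<and> (\<forall>\<omega>\<in>space (P \<theta>).
            (\<lambda>\<eta>. ln (pseudo_likelihood lag \<Delta> K X n \<eta> \<omega>)) differentiable (at \<theta>) \<and>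
            pseudo_score lag \<Delta> K X n \<theta> \<omega> = Atilde lag \<Delta> K \<theta> *v (\<Sum>i = CARD('k)..<n. H i \<theta> \<omega>))
       \<and> integrable (P \<theta>) (\<lambda>\<omega>. outer (H CARD('k) \<theta> \<omega>))
       \<and> M1 lag \<Delta> P X \<theta> = vcat (hcat (v \<theta> *\<^sub>R \<K> \<theta>) (0 :: real^1^'k))
                             (hcat (0 :: real^'k^1) (mat (2 * (v \<theta>)\<^sup>2) :: real^1^1))
       \<and> invertible (M1 lag \<Delta> P X \<theta>)
       \<and> (\<forall>i\<in>{CARD('k)..<n}.
            (\<forall>\<omega>\<in>space (P \<theta>). (\<lambda>\<eta>. H i \<eta> \<omega>) differentiable (at \<theta>)) \<and>
            integrable (P \<theta>) (\<lambda>\<omega>. jacobian (\<lambda>\<eta>. H i \<eta> \<omega>) (at \<theta>)) \<and>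
            transpose (sensitivity lag \<Delta> P X i \<theta>) =
              - vcat (\<K> \<theta> ** jacobian \<phi> (at \<theta>)) (rowvector (grad v \<theta>) :: real^'p^1) \<and>
            Atilde lag \<Delta> K \<theta> = - (sensitivity lag \<Delta> P X i \<theta> ** matrix_inv (M1 lag \<Delta> P X \<theta>))))"
proof -
  note defs = K_def H_def \<phi>_def v_def \<K>_def
  have diff: "\<phi> differentiable (at \<theta>)" "v differentiable (at \<theta>)" if "\<theta> \<in> interior \<Theta>" for \<theta>
    unfolding \<phi>_def v_def
    by (rule differentiable_phi_pvar[OF open_interior that];
        use nondegenerate smooth that interior_subset[of \<Theta>] in
          \<open>auto simp: defs continuously_differentiable_on_def\<close>)+
  have score: "(\<lambda>\<eta>. ln (pseudo_likelihood lag \<Delta> K X n \<eta> \<omega>)) differentiable (at \<theta>)"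
    "pseudo_score lag \<Delta> K X n \<theta> \<omega> = Atilde lag \<Delta> K \<theta> *v (\<Sum>i = CARD('k)..<n. H i \<theta> \<omega>)"
    if "\<theta> \<in> interior \<Theta>" for \<theta> \<omega>
    unfolding K_def H_def
    by (rule pseudo_score_eq[OF open_interior that];
        use nondegenerate diff[OF that] interior_subset[of \<Theta>] in \<open>auto simp: defs\<close>)+
  \<comment> \<open>The existentially quantified weight is \<open>Atilde\<close>, which does not
    depend on \<open>\<omega>\<close>.\<close>
  have estimating: "prediction_based_estimating_function lag \<Delta> K X n (interior \<Theta>) (\<Union>\<theta>\<in>\<Theta>. space (P \<theta>))
           (pseudo_score lag \<Delta> K X n)"
    unfolding prediction_based_estimating_function_def
    using score(2) unfolding H_def K_def by blast
  show ?thesis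
  proof (rule conjI[OF estimating], rule ballI, goal_cases)
    case \<theta>: (1 \<theta>)
    have "\<theta> \<in> \<Theta>" using \<theta> interior_subset by blast
    then have inv: "invertible (\<K> \<theta>)" and pos: "v \<theta> > 0" and prob: "prob_space (P \<theta>)"
      and r: "r \<theta> \<ge> 0" and stat: "stationary_process (P \<theta>) {-r \<theta>..} X"
      and gauss: "centred_gaussian_process (P \<theta>) {-r \<theta>..} X"
      using nondegenerate model
      by (auto simp: gaussian_sdde_model_def stationary_sdde_solution_def)
    \<comment> \<open>The placeholder is the condition \<open>i \<ge> CARD('k)\<close>, left open so
      that \<open>i\<close> can be chosen at each use.\<close>
    note ctx = lag \<Delta> _ prob r stat gauss inv[unfolded \<K>_def]
    let ?B = "vcat (hcat (v \<theta> *\<^sub>R \<K> \<theta>) (0 :: real^1^'k)) (hcat (0 :: real^'k^1) (mat (2 * (v \<theta>)\<^sup>2) :: real^1^1))"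
    have out: "has_bochner_integral (P \<theta>) (\<lambda>\<omega>. outer (H CARD('k) \<theta> \<omega>)) ?B"
      unfolding defs by (rule outer_Hvec_integral[OF ctx]) simp
    then have M1: "M1 lag \<Delta> P X \<theta> = ?B"
      by (simp add: has_bochner_integral_iff M1_def H_def)
    have inv_scale: "invertible (c *\<^sub>R A)" if "c \<noteq> 0" "invertible A" for c and A :: "real^'m^'m"
      using that by (simp add: scalar_invertible)
    have "invertible (mat 1 :: real^1^1)"
      unfolding invertible_def by (rule exI[of _ "mat 1"]) simp
    moreover have "mat (2 * (v \<theta>)\<^sup>2) = (2 * (v \<theta>)\<^sup>2) *\<^sub>R (mat 1 :: real^1^1)"
      by (simp add: mat_def vec_eq_iff)
    \<comment> \<open>Both diagonal blocks are invertible matrices scaled by a nonzero factor,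
      because \<open>v \<theta> > 0\<close>.\<close>
    ultimately have inv_B: "invertible ?B"
      using pos inv by (intro invertible_block_diag) (simp_all add: inv_scale)
    have S: "(\<forall>\<omega>\<in>space (P \<theta>). (\<lambda>\<eta>. H i \<eta> \<omega>) differentiable (at \<theta>)) \<and>
            integrable (P \<theta>) (\<lambda>\<omega>. jacobian (\<lambda>\<eta>. H i \<eta> \<omega>) (at \<theta>)) \<and>
            transpose (sensitivity lag \<Delta> P X i \<theta>) =
              - vcat (\<K> \<theta> ** jacobian \<phi> (at \<theta>)) (rowvector (grad v \<theta>) :: real^'p^1)"
      if "i \<ge> CARD('k)" for i
      using jacobian_Hvec_integral[OF ctx, OF that diff[OF \<theta>, unfolded \<phi>_def v_def]]
      by (auto simp: has_bochner_integral_iff sensitivity_def transpose_transpose defs)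
    \<comment> \<open>The identity \<open>S = - A M\<close> is checked blockwise and then multiplied
      from the right by the inverse of \<open>M\<close>, so the inverse is never computed.\<close>
    have A: "Atilde lag \<Delta> K \<theta> = - (sensitivity lag \<Delta> P X i \<theta> ** matrix_inv (M1 lag \<Delta> P X \<theta>))"
      if "i \<ge> CARD('k)" for i
    proof -
      have "sensitivity lag \<Delta> P X i \<theta> = transpose (transpose (sensitivity lag \<Delta> P X i \<theta>))"
        by (simp add: transpose_transpose)
      also have "\<dots> = transpose (- vcat (\<K> \<theta> ** jacobian \<phi> (at \<theta>)) (rowvector (grad v \<theta>) :: real^'p^1))"
        using S[OF that] by simp
      \<comment> \<open>Transposition reverses the product in the upper block, and the covariance
        matrix is its own transpose.\<close>
      also have "\<dots> = - hcat (transpose (jacobian \<phi> (at \<theta>)) ** \<K> \<theta>) (columnvector (grad v \<theta>) :: real^1^'p)"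
        by (simp add: transpose_uminus transpose_vcat matrix_transpose_mul transpose_rowvector
            \<K>_def Kmat_transpose)
      also have "\<dots> = - (Atilde lag \<Delta> K \<theta> ** ?B)"
      proof -
        \<comment> \<open>The factors \<open>v\<close> and \<open>2 v^2\<close> in the diagonal
          blocks cancel the denominators of the weights.\<close>
        have "Atilde lag \<Delta> K \<theta> ** ?B = 
          hcat (transpose (jacobian \<phi> (at \<theta>)) ** \<K> \<theta>) (columnvector (grad v \<theta>) :: real^1^'p)"
          using pos unfolding Atilde_def defs
          by (simp add: hcat_mult_vcat mult_hcat hcat_add)
            (simp add: matrix_matrix_mult_def vec_eq_iff hcat_def mat_def sum_distrib_left sum_1 
              flip: sum_divide_distrib split: sum.split)
        then show ?thesis by simp
      qed
      finally have "- sensitivity lag \<Delta> P X i \<theta> ** matrix_inv ?B = Atilde lag \<Delta> K \<theta> ** (?B ** matrix_inv ?B)"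
        by (simp add: matrix_mul_assoc)
      also have "\<dots> = Atilde lag \<Delta> K \<theta>"
        by (simp add: matrix_inv_mult[OF inv_B])
      finally show ?thesis by (simp add: M1 matrix_uminus_mult)
    qed
    show ?case
      using diff[OF \<theta>] score[OF \<theta>] out M1 inv_B S A
      by (simp add: has_bochner_integral_iff)
  qed
qed

end
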